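(* Let $R$ be an integral domain and let $G$ be a subgroup of $\mathrm{Aut}(R)$ whose action on $R$ is locally finite. If $R$ is a G-domain, then the fixed ring $R^G$ is also a G-domain.
   Context: All rings are commutative with unity. $\mathrm{Aut}(R)$ is the group of ring automorphisms of $R$. For a subgroup $G$ of $\mathrm{Aut}(R)$, the fixed ring is $R^G=\{r\in R : \sigma(r)=r \text{ for all } \sigma\in G\}$. The action of $G$ on $R$ is locally finite if for every $r\in R$ the orbit $\{\sigma(r) : \sigma\in G\}$ is finite ($G$ itself need not be finite). An integral domain $R$ with quotient field $K$ is a G-domain if $K$ is finitely generated as a ring over $R$; equivalently, if $K$ can be generated as a ring over $R$ by a single element. (The "G" in "G-domain" is unrelated to the group $G$.) *)

theory Defs
  imports "HOL-Algebra.Algebra"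
begin

section \<open>Ring automorphisms and fixed rings\<close>

text \<open>
  Ring analogue of \<^const>\<open>AutoGroup\<close>. As there, an automorphism is represented by an
  \<^const>\<open>extensional\<close> function, so that it is determined by its values on the carrier.
\<close>

definition ring_auto :: "('a, 'b) ring_scheme \<Rightarrow> ('a \<Rightarrow> 'a) set" where
  "ring_auto R = ring_hom R R \<inter> Bij (carrier R)"

definition RingAut :: "('a, 'b) ring_scheme \<Rightarrow> ('a \<Rightarrow> 'a) monoid" where
  "RingAut R = BijGroup (carrier R) \<lparr>carrier := ring_auto R\<rparr>"

definition fixed_ring :: "('a, 'b) ring_scheme \<Rightarrow> ('a \<Rightarrow> 'a) set \<Rightarrow> ('a, 'b) ring_scheme" where
  "fixed_ring R G = R \<lparr>carrier := {r \<in> carrier R. \<forall>\<sigma>\<in>G. \<sigma> r = r}\<rparr>"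

definition locally_finite_action :: "('a, 'b) ring_scheme \<Rightarrow> ('a \<Rightarrow> 'a) set \<Rightarrow> bool" where
  "locally_finite_action R G \<longleftrightarrow> (\<forall>r\<in>carrier R. finite {\<sigma> r | \<sigma>. \<sigma> \<in> G})"

lemma group_RingAut:
  assumes "ring R"
  shows "group (RingAut R)"
proof -
  interpret R: ring R by (fact assms)
  have id: "(\<lambda>x\<in>carrier R. x) \<in> ring_auto R"
    by (auto simp: ring_auto_def ring_hom_def id_Bij)
  have comp: "compose (carrier R) f g \<in> ring_auto R" if "f \<in> ring_auto R" "g \<in> ring_auto R" for f g
    proof -
    have "compose (carrier R) f g \<in> Bij (carrier R)"
      using that by (simp add: ring_auto_def compose_Bij)
    moreover have "compose (carrier R) f g \<in> ring_hom R R"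
      using that by (auto simp: ring_auto_def ring_hom_def compose_def Pi_iff)
    ultimately show ?thesis by (simp add: ring_auto_def)
  qed
  have inv: "restrict (inv_into (carrier R) f) (carrier R) \<in> ring_auto R"
    if f: "f \<in> ring_auto R" for f
  proof -
    have fB: "f \<in> Bij (carrier R)" and fh: "f \<in> ring_hom R R"
      using f by (auto simp: ring_auto_def)
    have "inv_into (carrier R) f \<one>\<^bsub>R\<^esub> = \<one>\<^bsub>R\<^esub>"
      using fB ring_hom_one[OF fh] by (metis Bij_def Int_iff R.one_closed bij_betw_def inv_into_f_f mem_Collect_eq)
    moreover have "inv_into (carrier R) f (x \<otimes>\<^bsub>R\<^esub> y)
        = inv_into (carrier R) f x \<otimes>\<^bsub>R\<^esub> inv_into (carrier R) f y"
      if "x \<in> carrier R" "y \<in> carrier R" for x y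
      by (rule Bij_inv_into_lemma[OF _ fB]) (use that ring_hom_mult[OF fh] in auto)
    moreover have "inv_into (carrier R) f (x \<oplus>\<^bsub>R\<^esub> y)
        = inv_into (carrier R) f x \<oplus>\<^bsub>R\<^esub> inv_into (carrier R) f y"
      if "x \<in> carrier R" "y \<in> carrier R" for x y
      by (rule Bij_inv_into_lemma[OF _ fB]) (use that ring_hom_add[OF fh] in auto)
    ultimately show ?thesis
      using fB by (auto simp: ring_auto_def ring_hom_def restrict_inv_into_Bij Bij_inv_into_mem)
  qed
  have "subgroup (ring_auto R) (BijGroup (carrier R))"
  proof (rule group.subgroupI[OF group_BijGroup])
    show "ring_auto R \<subseteq> carrier (BijGroup (carrier R))"
      by (auto simp: ring_auto_def BijGroup_def)
    show "ring_auto R \<noteq> {}" using id by blast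
    show "inv\<^bsub>BijGroup (carrier R)\<^esub> f \<in> ring_auto R" if "f \<in> ring_auto R" for f
      using inv[OF that] that by (simp add: inv_BijGroup ring_auto_def)
    show "f \<otimes>\<^bsub>BijGroup (carrier R)\<^esub> g \<in> ring_auto R"
      if "f \<in> ring_auto R" "g \<in> ring_auto R" for f g
      using comp[OF that] that by (simp add: BijGroup_def ring_auto_def)
  qed
  then show ?thesis
    unfolding RingAut_def by (rule subgroup.subgroup_is_group) (rule group_BijGroup)
qed


section \<open>The quotient field of a domain\<close>

definition fraction_pairs :: "('a, 'b) ring_scheme \<Rightarrow> ('a \<times> 'a) set" where
  "fraction_pairs R = carrier R \<times> (carrier R - {\<zero>\<^bsub>R\<^esub>})"

definition fraction_rel :: "('a, 'b) ring_scheme \<Rightarrow> (('a \<times> 'a) \<times> ('a \<times> 'a)) set" where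
  "fraction_rel R = {((a, b), (c, d)). (a, b) \<in> fraction_pairs R \<and> (c, d) \<in> fraction_pairs R
                   \<and> a \<otimes>\<^bsub>R\<^esub> d = c \<otimes>\<^bsub>R\<^esub> b}"

definition fraction :: "('a, 'b) ring_scheme \<Rightarrow> 'a \<Rightarrow> 'a \<Rightarrow> ('a \<times> 'a) set" where
  "fraction R a b = fraction_rel R `` {(a, b)}"

definition quotient_field :: "('a, 'b) ring_scheme \<Rightarrow> ('a \<times> 'a) set ring" where
  "quotient_field R =
    \<lparr>carrier = fraction_pairs R // fraction_rel R,
     monoid.mult = (\<lambda>u v. \<Union>(a, b)\<in>u. \<Union>(c, d)\<in>v. fraction R (a \<otimes>\<^bsub>R\<^esub> c) (b \<otimes>\<^bsub>R\<^esub> d)),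
     monoid.one = fraction R \<one>\<^bsub>R\<^esub> \<one>\<^bsub>R\<^esub>,
     ring.zero = fraction R \<zero>\<^bsub>R\<^esub> \<one>\<^bsub>R\<^esub>,
     ring.add = (\<lambda>u v. \<Union>(a, b)\<in>u. \<Union>(c, d)\<in>v.
             fraction R ((a \<otimes>\<^bsub>R\<^esub> d) \<oplus>\<^bsub>R\<^esub> (c \<otimes>\<^bsub>R\<^esub> b)) (b \<otimes>\<^bsub>R\<^esub> d))\<rparr>"

definition quotient_embed :: "('a, 'b) ring_scheme \<Rightarrow> 'a \<Rightarrow> ('a \<times> 'a) set" where
  "quotient_embed R a = fraction R a \<one>\<^bsub>R\<^esub>"

text \<open>
  In a G-domain the quotient field is finitely generated as a ring (not merely as a field) over
  the image of the domain, hence \<^const>\<open>generate_ring\<close>.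
\<close>

definition G_domain :: "('a, 'b) ring_scheme \<Rightarrow> bool" where
  "G_domain R \<longleftrightarrow> domain R \<and>
     (\<exists>S. finite S \<and> S \<subseteq> carrier (quotient_field R) \<and>
          generate_ring (quotient_field R) (quotient_embed R ` carrier R \<union> S)
            = carrier (quotient_field R))"

context domain
begin

lemma fraction_rel_cross:
  assumes "a \<in> carrier R" "b \<in> carrier R" "c \<in> carrier R" "d \<in> carrier R"
    "e \<in> carrier R" "f \<in> carrier R" "d \<noteq> \<zero>"
    and 1: "a \<otimes> d = c \<otimes> b" and 2: "c \<otimes> f = e \<otimes> d"
  shows "a \<otimes> f = e \<otimes> b"
proof -
  have "d \<otimes> (a \<otimes> f) = (a \<otimes> d) \<otimes> f" using assms(1-6) by (simp add: m_ac)
  also have "\<dots> = (c \<otimes> f) \<otimes> b" unfolding 1 using assms(1-6) by (simp add: m_ac)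
  also have "\<dots> = d \<otimes> (e \<otimes> b)" unfolding 2 using assms(1-6) by (simp add: m_ac)
  finally show ?thesis using assms m_lcancel by simp
qed

lemma equiv_fraction_rel: "equiv (fraction_pairs R) (fraction_rel R)"
proof (rule equivI)
  show "fraction_rel R \<subseteq> fraction_pairs R \<times> fraction_pairs R" by (auto simp: fraction_rel_def)
  show "refl_on (fraction_pairs R) (fraction_rel R)" by (auto simp: refl_on_def fraction_rel_def)
  show "sym (fraction_rel R)" by (auto simp: sym_def fraction_rel_def)
  show "trans (fraction_rel R)"
    by (rule transI) (auto simp: fraction_rel_def fraction_pairs_def intro: fraction_rel_cross)
qed

lemma fraction_closed:
  assumes "a \<in> carrier R" "b \<in> carrier R" "b \<noteq> \<zero>"
  shows "fraction R a b \<in> carrier (quotient_field R)"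
  using assms by (auto simp: fraction_def quotient_field_def fraction_pairs_def intro: quotientI)

lemma fraction_cases:
  assumes "u \<in> carrier (quotient_field R)"
  obtains a b where "a \<in> carrier R" "b \<in> carrier R" "b \<noteq> \<zero>" "u = fraction R a b"
  using assms by (auto simp: fraction_def quotient_field_def fraction_pairs_def elim!: quotientE)

lemma fraction_eq_iff:
  assumes "a \<in> carrier R" "b \<in> carrier R" "b \<noteq> \<zero>" "c \<in> carrier R" "d \<in> carrier R" "d \<noteq> \<zero>"
  shows "fraction R a b = fraction R c d \<longleftrightarrow> a \<otimes> d = c \<otimes> b"
proof -
  have "fraction R a b = fraction R c d \<longleftrightarrow> ((a, b), (c, d)) \<in> fraction_rel R"
    unfolding fraction_def by (rule eq_equiv_class_iff[OF equiv_fraction_rel])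
      (use assms in \<open>auto simp: fraction_pairs_def\<close>)
  then show ?thesis using assms by (simp add: fraction_rel_def fraction_pairs_def)
qed

lemma fraction_class_UN2:
  assumes cong: "\<And>a b a' b' c d c' d'. \<lbrakk>((a, b), (a', b')) \<in> fraction_rel R; ((c, d), (c', d')) \<in> fraction_rel R\<rbrakk>
      \<Longrightarrow> h a b c d = h a' b' c' d'"
    and "a \<in> carrier R" "b \<in> carrier R" "b \<noteq> \<zero>" "c \<in> carrier R" "d \<in> carrier R" "d \<noteq> \<zero>"
  shows "(\<Union>(a, b)\<in>fraction R a b. \<Union>(c, d)\<in>fraction R c d. h a b c d) = h a b c d"
proof -
  have ab: "(a, b) \<in> fraction_pairs R" and cd: "(c, d) \<in> fraction_pairs R"
    using assms by (auto simp: fraction_pairs_def)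
  have "congruent2 (fraction_rel R) (fraction_rel R) (\<lambda>(a, b) (c, d). h a b c d)"
    by (rule congruent2I') (auto dest: cong)
  from UN_equiv_class2[OF equiv_fraction_rel equiv_fraction_rel this ab cd]
  show ?thesis unfolding fraction_def by (simp add: case_prod_unfold)
qed

lemma fraction_mult:
  assumes "a \<in> carrier R" "b \<in> carrier R" "b \<noteq> \<zero>" "c \<in> carrier R" "d \<in> carrier R" "d \<noteq> \<zero>"
  shows "fraction R a b \<otimes>\<^bsub>quotient_field R\<^esub> fraction R c d = fraction R (a \<otimes> c) (b \<otimes> d)"
proof -
  have "fraction R (a \<otimes> c) (b \<otimes> d) = fraction R (a' \<otimes> c') (b' \<otimes> d')"
    if "((a, b), (a', b')) \<in> fraction_rel R" "((c, d), (c', d')) \<in> fraction_rel R" for a b c d a' b' c' d'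
  proof -
    have cl: "a \<in> carrier R" "b \<in> carrier R" "b \<noteq> \<zero>" "c \<in> carrier R" "d \<in> carrier R" "d \<noteq> \<zero>"
      "a' \<in> carrier R" "b' \<in> carrier R" "b' \<noteq> \<zero>" "c' \<in> carrier R" "d' \<in> carrier R" "d' \<noteq> \<zero>"
      and e1: "a \<otimes> b' = a' \<otimes> b" and e2: "c \<otimes> d' = c' \<otimes> d"
      using that by (auto simp: fraction_rel_def fraction_pairs_def)
    have "(a \<otimes> c) \<otimes> (b' \<otimes> d') = (a \<otimes> b') \<otimes> (c \<otimes> d')" using cl by (simp add: m_ac)
    also have "\<dots> = (a' \<otimes> c') \<otimes> (b \<otimes> d)" unfolding e1 e2 using cl by (simp add: m_ac)
    finally show ?thesis using cl by (simp add: fraction_eq_iff integral_iff)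
  qed
  from fraction_class_UN2[of "\<lambda>a b c d. fraction R (a \<otimes> c) (b \<otimes> d)", OF this assms]
  show ?thesis by (simp add: quotient_field_def)
qed

lemma fraction_add:
  assumes "a \<in> carrier R" "b \<in> carrier R" "b \<noteq> \<zero>" "c \<in> carrier R" "d \<in> carrier R" "d \<noteq> \<zero>"
  shows "fraction R a b \<oplus>\<^bsub>quotient_field R\<^esub> fraction R c d = fraction R ((a \<otimes> d) \<oplus> (c \<otimes> b)) (b \<otimes> d)"
proof -
  have "fraction R ((a \<otimes> d) \<oplus> (c \<otimes> b)) (b \<otimes> d) = fraction R ((a' \<otimes> d') \<oplus> (c' \<otimes> b')) (b' \<otimes> d')"
    if "((a, b), (a', b')) \<in> fraction_rel R" "((c, d), (c', d')) \<in> fraction_rel R" for a b c d a' b' c' d'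
  proof -
    have cl: "a \<in> carrier R" "b \<in> carrier R" "b \<noteq> \<zero>" "c \<in> carrier R" "d \<in> carrier R" "d \<noteq> \<zero>"
      "a' \<in> carrier R" "b' \<in> carrier R" "b' \<noteq> \<zero>" "c' \<in> carrier R" "d' \<in> carrier R" "d' \<noteq> \<zero>"
      and e1: "a \<otimes> b' = a' \<otimes> b" and e2: "c \<otimes> d' = c' \<otimes> d"
      using that by (auto simp: fraction_rel_def fraction_pairs_def)
    have "((a \<otimes> d) \<oplus> (c \<otimes> b)) \<otimes> (b' \<otimes> d')
        = (a \<otimes> b') \<otimes> (d \<otimes> d') \<oplus> (c \<otimes> d') \<otimes> (b \<otimes> b')"
      using cl by (simp add: l_distr r_distr m_ac)
    also have "\<dots> = ((a' \<otimes> d') \<oplus> (c' \<otimes> b')) \<otimes> (b \<otimes> d)"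
      unfolding e1 e2 using cl by (simp add: l_distr r_distr m_ac)
    finally show ?thesis using cl by (simp add: fraction_eq_iff integral_iff)
  qed
  from fraction_class_UN2[of "\<lambda>a b c d. fraction R ((a \<otimes> d) \<oplus> (c \<otimes> b)) (b \<otimes> d)", OF this assms]
  show ?thesis by (simp add: quotient_field_def)
qed

lemma quotient_field_one: "\<one>\<^bsub>quotient_field R\<^esub> = fraction R \<one> \<one>"
  and quotient_field_zero: "\<zero>\<^bsub>quotient_field R\<^esub> = fraction R \<zero> \<one>"
  by (simp_all add: quotient_field_def)

lemma cring_quotient_field: "cring (quotient_field R)"
proof (rule cringI)
  note simps = fraction_mult fraction_add fraction_closed fraction_eq_iff integral_iff
    quotient_field_one quotient_field_zero
  show "abelian_group (quotient_field R)"
  proof (rule abelian_groupI)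
    fix u assume "u \<in> carrier (quotient_field R)"
    then obtain a b where u: "a \<in> carrier R" "b \<in> carrier R" "b \<noteq> \<zero>" "u = fraction R a b"
      by (rule fraction_cases)
    have "fraction R (\<ominus> a) b \<oplus>\<^bsub>quotient_field R\<^esub> u = \<zero>\<^bsub>quotient_field R\<^esub>"
      using u by (simp add: simps l_minus l_neg)
    then show "\<exists>v\<in>carrier (quotient_field R). v \<oplus>\<^bsub>quotient_field R\<^esub> u = \<zero>\<^bsub>quotient_field R\<^esub>"
      using u by (intro bexI[of _ "fraction R (\<ominus> a) b"]) (auto simp: simps)
  qed ((elim fraction_cases)?, simp add: simps l_distr r_distr m_ac a_ac)+
  show "comm_monoid (quotient_field R)"
    by (rule comm_monoidI) ((elim fraction_cases)?, simp add: simps m_ac)+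
  show "(u \<oplus>\<^bsub>quotient_field R\<^esub> v) \<otimes>\<^bsub>quotient_field R\<^esub> w =
      u \<otimes>\<^bsub>quotient_field R\<^esub> w \<oplus>\<^bsub>quotient_field R\<^esub> v \<otimes>\<^bsub>quotient_field R\<^esub> w"
    if "u \<in> carrier (quotient_field R)" "v \<in> carrier (quotient_field R)"
      "w \<in> carrier (quotient_field R)" for u v w
    using that by (elim fraction_cases) (simp add: simps l_distr r_distr m_ac)
qed

lemma field_quotient_field: "field (quotient_field R)"
proof (rule cring.cring_fieldI2[OF cring_quotient_field])
  show "\<zero>\<^bsub>quotient_field R\<^esub> \<noteq> \<one>\<^bsub>quotient_field R\<^esub>"
    by (simp add: quotient_field_one quotient_field_zero fraction_eq_iff)
  fix u assume "u \<in> carrier (quotient_field R)" and nz: "u \<noteq> \<zero>\<^bsub>quotient_field R\<^esub>"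
  then obtain a b where u: "a \<in> carrier R" "b \<in> carrier R" "b \<noteq> \<zero>" "u = fraction R a b"
    by (elim fraction_cases)
  have "a \<noteq> \<zero>" using nz u by (auto simp: quotient_field_zero fraction_eq_iff)
  then show "\<exists>v\<in>carrier (quotient_field R). u \<otimes>\<^bsub>quotient_field R\<^esub> v = \<one>\<^bsub>quotient_field R\<^esub>"
    using u by (intro bexI[of _ "fraction R b a"])
      (auto simp: fraction_mult fraction_closed fraction_eq_iff integral_iff quotient_field_one m_ac)
qed

lemma quotient_embed_hom: "quotient_embed R \<in> ring_hom R (quotient_field R)"
  by (rule ring_hom_memI)
    (auto simp: quotient_embed_def fraction_closed fraction_mult fraction_add quotient_field_one)

lemma quotient_embed_inj: "inj_on (quotient_embed R) (carrier R)"
  by (rule inj_onI) (simp add: quotient_embed_def fraction_eq_iff)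

lemma fraction_mult_denom:
  assumes "a \<in> carrier R" "b \<in> carrier R" "b \<noteq> \<zero>"
  shows "fraction R a b \<otimes>\<^bsub>quotient_field R\<^esub> quotient_embed R b = quotient_embed R a"
  using assms by (simp add: quotient_embed_def fraction_mult fraction_eq_iff)

end

end

theory Submission
  imports Defs
begin

text \<open>
  A domain \<open>R\<close> is a G-domain exactly when it has a nonzero element \<open>u\<close> such that every nonzero
  element of \<open>R\<close> divides some power of \<open>u\<close> (lemma \<open>G_domain_iff_divides_power\<close>): the quotient
  field is then the localization \<open>R[1/u]\<close>, and conversely finitely many ring generators of the
  quotient field have a common denominator \<open>u\<close>.

  Suppose that \<open>R\<close> has such a \<open>u\<close>. As the action is locally finite, the orbit of \<open>u\<close> is finite,
  and the product \<open>v\<close> of its members, the norm of \<open>u\<close>, is a nonzero invariant element that \<open>u\<close>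
  divides. So every nonzero invariant \<open>b\<close> divides a power of \<open>v\<close> in \<open>R\<close>, say \<open>v\<^sup>n = b c\<close>. Since
  \<open>v\<^sup>n\<close> and \<open>b\<close> are invariant and \<open>b\<close> can be cancelled, \<open>c\<close> is invariant as well
  (lemma \<open>divides_fixed_ring\<close>). Hence \<open>b\<close> divides \<open>v\<^sup>n\<close> already in the fixed ring, and \<open>v\<close> is the
  element required of the fixed ring.
\<close>

section \<open>G-domains and divisibility of powers\<close>

context domain
begin

lemma nat_pow_nonzero:
  assumes "u \<in> carrier R" "u \<noteq> \<zero>"
  shows "u [^] (n::nat) \<noteq> \<zero>"
  using assms by (induction n) (auto simp: integral_iff)

lemma finprod_nonzero:
  assumes "finite A" "A \<subseteq> carrier R - {\<zero>}"
  shows "(\<Otimes>x\<in>A. x) \<noteq> \<zero>"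
  using assms
proof (induction A rule: finite_induct)
  case (insert a A)
  then have "a \<in> carrier R" "(\<lambda>x. x) \<in> A \<rightarrow> carrier R" by auto
  with insert show ?case by (simp add: integral_iff)
qed simp

lemma finite_common_denominator:
  assumes "finite S" "S \<subseteq> carrier (quotient_field R)"
  obtains u where "u \<in> carrier R" "u \<noteq> \<zero>" "\<And>s. s \<in> S \<Longrightarrow> \<exists>a\<in>carrier R. s = fraction R a u"
proof -
  have "\<exists>u\<in>carrier R. u \<noteq> \<zero> \<and> (\<forall>s\<in>S. \<exists>a\<in>carrier R. s = fraction R a u)"
    using assms
  proof (induction S rule: finite_induct)
    case empty
    show ?case by (intro bexI[of _ \<one>]) auto
  next
    case (insert s S)
    then obtain u where u: "u \<in> carrier R" "u \<noteq> \<zero>"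
        and S: "\<forall>s\<in>S. \<exists>a\<in>carrier R. s = fraction R a u"
      by auto
    have "s \<in> carrier (quotient_field R)" using insert.prems by simp
    then obtain c d where s: "c \<in> carrier R" "d \<in> carrier R" "d \<noteq> \<zero>" "s = fraction R c d"
      by (rule fraction_cases)
    have "\<exists>a\<in>carrier R. t = fraction R a (u \<otimes> d)" if t: "t \<in> S" for t
    proof -
      obtain a where a: "a \<in> carrier R" "t = fraction R a u"
        using S t by blast
      have "t = fraction R (a \<otimes> d) (u \<otimes> d)"
        unfolding a(2) using a(1) u s(1-3) by (simp add: fraction_eq_iff integral_iff m_ac)
      then show ?thesis using a(1) s(2) by blast
    qed
    moreover have "s = fraction R (c \<otimes> u) (u \<otimes> d)"
      unfolding s(4) using u s(1-3) by (simp add: fraction_eq_iff integral_iff m_ac)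
    ultimately have "\<forall>t\<in>insert s S. \<exists>a\<in>carrier R. t = fraction R a (u \<otimes> d)"
      using u(1) s(1) by blast
    moreover have "u \<otimes> d \<in> carrier R" "u \<otimes> d \<noteq> \<zero>"
      using u s(2,3) by (auto simp: integral_iff)
    ultimately show ?case by blast
  qed
  then show thesis using that by blast
qed

text \<open>The localization \<open>R[1/u]\<close> inside the quotient field.\<close>

definition power_fractions :: "'a \<Rightarrow> ('a \<times> 'a) set set" where
  "power_fractions u = {fraction R a (u [^] n) | a (n::nat). a \<in> carrier R}"

lemma power_fractions_subring:
  assumes u: "u \<in> carrier R" "u \<noteq> \<zero>"
  shows "subring (power_fractions u) (quotient_field R)"
proof -
  interpret K: field "quotient_field R" by (rule field_quotient_field)
  note pow = nat_pow_closed[OF u(1)] nat_pow_nonzero[OF u]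
  note simps = fraction_mult fraction_add fraction_closed fraction_eq_iff integral_iff
    quotient_field_one quotient_field_zero pow
  show ?thesis
  proof (rule K.subringI)
    show "power_fractions u \<subseteq> carrier (quotient_field R)"
      by (auto simp: power_fractions_def simps)
    show "\<one>\<^bsub>quotient_field R\<^esub> \<in> power_fractions u"
      unfolding power_fractions_def quotient_field_one
      by (intro CollectI exI[of _ \<one>] exI[of _ "0::nat"]) simp
  next
    fix x assume "x \<in> power_fractions u"
    then obtain a and n :: nat where x: "a \<in> carrier R" "x = fraction R a (u [^] n)"
      by (auto simp: power_fractions_def)
    have "fraction R (\<ominus> a) (u [^] n) \<oplus>\<^bsub>quotient_field R\<^esub> x = \<zero>\<^bsub>quotient_field R\<^esub>"
      using x by (simp add: simps l_minus l_neg)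
    then have "\<ominus>\<^bsub>quotient_field R\<^esub> x = fraction R (\<ominus> a) (u [^] n)"
      using x by (intro K.minus_equality) (auto simp: simps)
    then show "\<ominus>\<^bsub>quotient_field R\<^esub> x \<in> power_fractions u"
      using x by (auto simp: power_fractions_def)
  next
    fix x y assume "x \<in> power_fractions u" "y \<in> power_fractions u"
    then obtain a b and n m :: nat
      where x: "a \<in> carrier R" "x = fraction R a (u [^] n)"
        and y: "b \<in> carrier R" "y = fraction R b (u [^] m)"
      by (auto simp: power_fractions_def)
    have "x \<otimes>\<^bsub>quotient_field R\<^esub> y = fraction R (a \<otimes> b) (u [^] (n + m))"
      using x y u by (simp add: simps nat_pow_mult)
    then show "x \<otimes>\<^bsub>quotient_field R\<^esub> y \<in> power_fractions u"
      using x y unfolding power_fractions_def by blast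
    have "x \<oplus>\<^bsub>quotient_field R\<^esub> y =
        fraction R (a \<otimes> u [^] m \<oplus> b \<otimes> u [^] n) (u [^] (n + m))"
      using x y u by (simp add: simps nat_pow_mult)
    moreover have "a \<otimes> u [^] m \<oplus> b \<otimes> u [^] n \<in> carrier R"
      using x y u by simp
    ultimately show "x \<oplus>\<^bsub>quotient_field R\<^esub> y \<in> power_fractions u"
      unfolding power_fractions_def by blast
  qed
qed

text \<open>
  With a common denominator \<open>u\<close> of the ring generators, the subring \<open>R[1/u]\<close> is the whole
  quotient field. So it contains \<open>1/b\<close>, and \<open>1/b = a/u\<^sup>n\<close> says that \<open>u\<^sup>n = b a\<close>.
\<close>

lemma G_domain_imp_divides_power:
  assumes "G_domain R"
  shows "\<exists>u\<in>carrier R - {\<zero>}. \<forall>b\<in>carrier R - {\<zero>}. \<exists>n::nat. b divides u [^] n"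
proof -
  interpret K: field "quotient_field R" by (rule field_quotient_field)
  obtain S where S: "finite S" "S \<subseteq> carrier (quotient_field R)"
      "generate_ring (quotient_field R) (quotient_embed R ` carrier R \<union> S)
        = carrier (quotient_field R)"
    using assms by (auto simp: G_domain_def)
  obtain u where u: "u \<in> carrier R" "u \<noteq> \<zero>"
      and Su: "\<And>s. s \<in> S \<Longrightarrow> \<exists>a\<in>carrier R. s = fraction R a u"
    using finite_common_denominator[OF S(1,2)] by blast
  have "quotient_embed R a \<in> power_fractions u" if "a \<in> carrier R" for a
    unfolding power_fractions_def quotient_embed_def
    by (intro CollectI exI[of _ a] exI[of _ "0::nat"]) (simp add: that)
  moreover have "s \<in> power_fractions u" if s: "s \<in> S" for s
  proof -
    obtain a where "a \<in> carrier R" "s = fraction R a u" using Su[OF s] by blast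
    then show ?thesis
      unfolding power_fractions_def using u
      by (intro CollectI exI[of _ a] exI[of _ "1::nat"]) simp
  qed
  ultimately have gens: "quotient_embed R ` carrier R \<union> S \<subseteq> power_fractions u"
    by blast
  then have "quotient_embed R ` carrier R \<union> S \<subseteq> carrier (quotient_field R)"
    using subringE(1)[OF power_fractions_subring[OF u]] by blast
  from K.generate_ring_min_subring1[OF this power_fractions_subring[OF u] gens]
  have all: "carrier (quotient_field R) \<subseteq> power_fractions u"
    by (simp add: S(3))
  have "\<exists>n::nat. b divides u [^] n" if b: "b \<in> carrier R - {\<zero>}" for b
  proof -
    have "fraction R \<one> b \<in> power_fractions u"
      using all b by (auto simp: fraction_closed)
    then obtain a and n :: nat where a: "a \<in> carrier R" "fraction R \<one> b = fraction R a (u [^] n)"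
      by (auto simp: power_fractions_def)
    then have "u [^] n = b \<otimes> a"
      using b u by (simp add: fraction_eq_iff nat_pow_nonzero m_comm)
    then show ?thesis using a(1) by blast
  qed
  then show ?thesis using u by blast
qed

text \<open>
  The quotient field is generated over \<open>R\<close> by \<open>1/u\<close> alone: if \<open>u\<^sup>n = b c\<close>, then
  \<open>a/b = a c (1/u)\<^sup>n\<close>.
\<close>

lemma divides_power_imp_G_domain:
  assumes u: "u \<in> carrier R" "u \<noteq> \<zero>"
    and div: "\<And>b. b \<in> carrier R \<Longrightarrow> b \<noteq> \<zero> \<Longrightarrow> \<exists>n::nat. b divides u [^] n"
  shows "G_domain R"
proof -
  interpret K: field "quotient_field R" by (rule field_quotient_field)
  let ?H = "quotient_embed R ` carrier R \<union> {fraction R \<one> u}"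
  let ?A = "generate_ring (quotient_field R) ?H"
  have H: "?H \<subseteq> carrier (quotient_field R)"
    using u by (auto simp: quotient_embed_def fraction_closed)
  have pow: "fraction R \<one> (u [^] n) \<in> ?A" for n :: nat
  proof (induction n)
    case 0
    show ?case using generate_ring.one[of "quotient_field R" ?H] by (simp add: quotient_field_one)
  next
    case (Suc n)
    have "fraction R \<one> u \<in> ?A" by (intro generate_ring.incl) simp
    from generate_ring.eng_mult[OF Suc this] show ?case
      using u by (simp add: fraction_mult nat_pow_nonzero)
  qed
  have "x \<in> ?A" if x: "x \<in> carrier (quotient_field R)" for x
  proof -
    obtain a b where ab: "a \<in> carrier R" "b \<in> carrier R" "b \<noteq> \<zero>" "x = fraction R a b"
      using x by (rule fraction_cases)
    obtain n :: nat and c where c: "c \<in> carrier R" "u [^] n = b \<otimes> c"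
      using div[OF ab(2,3)] by auto
    have nz: "b \<otimes> c \<noteq> \<zero>" using nat_pow_nonzero[OF u, of n] c by simp
    have "x = fraction R (a \<otimes> c) (b \<otimes> c)"
      using ab c nz by (simp add: fraction_eq_iff m_ac)
    also have "\<dots> = quotient_embed R (a \<otimes> c) \<otimes>\<^bsub>quotient_field R\<^esub> fraction R \<one> (u [^] n)"
      using ab c nz by (simp add: quotient_embed_def fraction_mult)
    also have "\<dots> \<in> ?A"
      using ab c by (intro generate_ring.eng_mult pow generate_ring.incl) simp
    finally show ?thesis .
  qed
  then have "?A = carrier (quotient_field R)"
    using K.generate_ring_incl[OF H] by blast
  then show ?thesis
    unfolding G_domain_def using u domain_axioms
    by (intro conjI exI[of _ "{fraction R \<one> u}"]) (auto simp: fraction_closed)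
qed

lemma G_domain_iff_divides_power:
  "G_domain R \<longleftrightarrow>
    (\<exists>u\<in>carrier R - {\<zero>}. \<forall>b\<in>carrier R - {\<zero>}. \<exists>n::nat. b divides u [^] n)"
  using G_domain_imp_divides_power divides_power_imp_G_domain by blast

end

section \<open>Fixed rings and norms\<close>

lemma fixed_ring_simps [simp]:
  "carrier (fixed_ring R G) = {r \<in> carrier R. \<forall>\<sigma>\<in>G. \<sigma> r = r}"
  "\<zero>\<^bsub>fixed_ring R G\<^esub> = \<zero>\<^bsub>R\<^esub>"
  "\<one>\<^bsub>fixed_ring R G\<^esub> = \<one>\<^bsub>R\<^esub>"
  "x \<otimes>\<^bsub>fixed_ring R G\<^esub> y = x \<otimes>\<^bsub>R\<^esub> y"
  "x [^]\<^bsub>fixed_ring R G\<^esub> (n::nat) = x [^]\<^bsub>R\<^esub> n"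
  by (simp_all add: fixed_ring_def nat_pow_def)

lemma ring_auto_ring_hom_cring:
  assumes "cring R" "\<sigma> \<in> ring_auto R"
  shows "ring_hom_cring R R \<sigma>"
  using assms by (auto simp: ring_auto_def ring_hom_cring_def ring_hom_cring_axioms_def)

lemma subgroup_RingAutD:
  assumes "ring R" "subgroup G (RingAut R)"
  shows "G \<subseteq> ring_auto R"
    and "(\<lambda>x\<in>carrier R. x) \<in> G"
    and "\<And>\<sigma> \<tau>. \<sigma> \<in> G \<Longrightarrow> \<tau> \<in> G \<Longrightarrow> compose (carrier R) \<sigma> \<tau> \<in> G"
proof -
  show sub: "G \<subseteq> ring_auto R"
    using subgroup.subset[OF assms(2)] by (simp add: RingAut_def)
  show "(\<lambda>x\<in>carrier R. x) \<in> G"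
    using subgroup.one_closed[OF assms(2)] by (simp add: RingAut_def BijGroup_def)
  show "compose (carrier R) \<sigma> \<tau> \<in> G" if "\<sigma> \<in> G" "\<tau> \<in> G" for \<sigma> \<tau>
  proof -
    have "\<sigma> \<in> Bij (carrier R)" "\<tau> \<in> Bij (carrier R)"
      using that sub by (auto simp: ring_auto_def)
    then show ?thesis
      using subgroup.m_closed[OF assms(2) that] by (simp add: RingAut_def BijGroup_def)
  qed
qed

context domain
begin

lemma domain_fixed_ring:
  assumes "G \<subseteq> ring_auto R"
  shows "domain (fixed_ring R G)"
proof -
  have fixed: "\<sigma> \<one> = \<one>" "\<sigma> x = x \<Longrightarrow> \<sigma> (\<ominus> x) = \<ominus> x"
      "\<sigma> x = x \<Longrightarrow> \<sigma> y = y \<Longrightarrow> \<sigma> (x \<otimes> y) = x \<otimes> y"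
      "\<sigma> x = x \<Longrightarrow> \<sigma> y = y \<Longrightarrow> \<sigma> (x \<oplus> y) = x \<oplus> y"
    if "\<sigma> \<in> G" "x \<in> carrier R" "y \<in> carrier R" for \<sigma> x y
  proof -
    interpret \<sigma>: ring_hom_cring R R \<sigma>
      using that(1) assms by (auto intro: ring_auto_ring_hom_cring is_cring)
    show "\<sigma> \<one> = \<one>" "\<sigma> x = x \<Longrightarrow> \<sigma> (\<ominus> x) = \<ominus> x"
      "\<sigma> x = x \<Longrightarrow> \<sigma> y = y \<Longrightarrow> \<sigma> (x \<otimes> y) = x \<otimes> y"
      "\<sigma> x = x \<Longrightarrow> \<sigma> y = y \<Longrightarrow> \<sigma> (x \<oplus> y) = x \<oplus> y"
      using that(2,3) by simp_all
  qed
  have "subring {r \<in> carrier R. \<forall>\<sigma>\<in>G. \<sigma> r = r} R"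
    by (rule subringI) (auto intro: fixed)
  then show ?thesis
    unfolding fixed_ring_def by (rule subring_is_domain)
qed

text \<open>
  The cofactor is invariant because it is unique: an automorphism fixing \<open>a\<close> and \<open>b = a c\<close> sends
  \<open>c\<close> to another cofactor of \<open>b\<close> by \<open>a\<close>. Uniqueness fails for \<open>a = \<zero>\<close>.
\<close>

lemma divides_fixed_ring:
  assumes G: "G \<subseteq> ring_auto R"
    and a: "a \<in> carrier (fixed_ring R G)" "a \<noteq> \<zero>"
    and b: "b \<in> carrier (fixed_ring R G)"
    and div: "a divides b"
  shows "a divides\<^bsub>fixed_ring R G\<^esub> b"
proof -
  obtain c where c: "c \<in> carrier R" "b = a \<otimes> c" using div by blast
  have "\<sigma> c = c" if s: "\<sigma> \<in> G" for \<sigma>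
  proof -
    interpret \<sigma>: ring_hom_cring R R \<sigma>
      using s G by (auto intro: ring_auto_ring_hom_cring is_cring)
    have fixed: "\<sigma> a = a" "\<sigma> b = b" using a b s by auto
    have "a \<otimes> \<sigma> c = \<sigma> (a \<otimes> c)" using a c fixed(1) by simp
    also have "\<dots> = a \<otimes> c" using fixed(2) c(2) by simp
    finally show ?thesis using a c m_lcancel by simp
  qed
  then show ?thesis using c by (auto simp: factor_def)
qed

text \<open>
  The norm of \<open>u\<close>, here the product of the distinct conjugates of \<open>u\<close>: a member of \<open>G\<close> permutes
  the orbit of \<open>u\<close> and so fixes this product.
\<close>

lemma invariant_multiple_of_finite_orbit:
  assumes G: "subgroup G (RingAut R)"
    and fin: "finite {\<sigma> u | \<sigma>. \<sigma> \<in> G}"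
    and u: "u \<in> carrier R" "u \<noteq> \<zero>"
  obtains v where "v \<in> carrier (fixed_ring R G)" "v \<noteq> \<zero>" "u divides v"
proof
  note G' = subgroup_RingAutD[OF ring_axioms G]
  let ?O = "{\<sigma> u | \<sigma>. \<sigma> \<in> G}"
  let ?v = "\<Otimes>x\<in>?O. x"
  have hom: "ring_hom_cring R R \<sigma>" if "\<sigma> \<in> G" for \<sigma>
    using that G'(1) by (auto intro: ring_auto_ring_hom_cring is_cring)
  have inj: "inj_on \<sigma> (carrier R)" if "\<sigma> \<in> G" for \<sigma>
    using that G'(1) by (auto simp: ring_auto_def Bij_def bij_betw_def)
  have O: "?O \<subseteq> carrier R - {\<zero>}"
  proof clarify
    fix \<sigma> assume s: "\<sigma> \<in> G"
    interpret \<sigma>: ring_hom_cring R R \<sigma> by (rule hom[OF s])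
    have "\<sigma> u \<noteq> \<zero>"
      using inj_onD[OF inj[OF s], of u \<zero>] u by auto
    then show "\<sigma> u \<in> carrier R - {\<zero>}" using u by simp
  qed
  have v: "?v \<in> carrier R" using O by (intro finprod_closed) auto
  have "\<sigma> ?v = ?v" if s: "\<sigma> \<in> G" for \<sigma>
  proof -
    interpret \<sigma>: ring_hom_cring R R \<sigma> by (rule hom[OF s])
    have injO: "inj_on \<sigma> ?O" using inj[OF s] O by (auto intro: inj_on_subset)
    have "\<sigma> (\<tau> u) \<in> ?O" if "\<tau> \<in> G" for \<tau>
      using G'(3)[OF s that] u by (auto simp: compose_def intro!: exI[of _ "compose (carrier R) \<sigma> \<tau>"])
    then have "\<sigma> ` ?O \<subseteq> ?O" by blast
    then have perm: "\<sigma> ` ?O = ?O" using fin injO by (intro endo_inj_surj)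
    have "\<sigma> ?v = (\<Otimes>x\<in>?O. \<sigma> x)"
      using O by (subst \<sigma>.hom_finprod) (auto simp: comp_def)
    also have "\<dots> = (\<Otimes>x\<in>\<sigma> ` ?O. x)"
      using O perm injO by (intro finprod_reindex[symmetric]) auto
    finally show ?thesis by (simp only: perm)
  qed
  then show "?v \<in> carrier (fixed_ring R G)" using v by simp
  show "?v \<noteq> \<zero>" using fin O by (rule finprod_nonzero)
  have "u \<in> ?O" using G'(2) u by (auto intro!: exI[of _ "\<lambda>x\<in>carrier R. x"])
  then have "?v = (\<Otimes>x\<in>insert u (?O - {u}). x)" by (simp only: insert_Diff)
  also have "\<dots> = u \<otimes> (\<Otimes>x\<in>?O - {u}. x)"
    using O fin u by (intro finprod_insert) auto
  finally show "u divides ?v"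
    using O by (intro dividesI[of "\<Otimes>x\<in>?O - {u}. x"] finprod_closed) auto
qed

end

theorem theorem2p6:
  fixes R :: "('a, 'b) ring_scheme" and G :: "('a \<Rightarrow> 'a) set"
  assumes "domain R"
    and "subgroup G (RingAut R)"
    and "locally_finite_action R G"
    and "G_domain R"
  shows "G_domain (fixed_ring R G)"
proof -
  interpret domain R by fact
  have G: "G \<subseteq> ring_auto R" by (rule subgroup_RingAutD(1)[OF ring_axioms assms(2)])
  interpret F: domain "fixed_ring R G" by (rule domain_fixed_ring[OF G])
  obtain u where u: "u \<in> carrier R" "u \<noteq> \<zero>\<^bsub>R\<^esub>"
      and div: "\<And>b. b \<in> carrier R - {\<zero>\<^bsub>R\<^esub>} \<Longrightarrow> \<exists>n::nat. b divides\<^bsub>R\<^esub> u [^]\<^bsub>R\<^esub> n"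
    using assms(4) by (auto simp: G_domain_iff_divides_power)
  have "finite {\<sigma> u | \<sigma>. \<sigma> \<in> G}"
    using assms(3) u(1) by (simp add: locally_finite_action_def)
  from invariant_multiple_of_finite_orbit[OF assms(2) this u]
  obtain v where v: "v \<in> carrier (fixed_ring R G)" "v \<noteq> \<zero>\<^bsub>R\<^esub>" "u divides\<^bsub>R\<^esub> v" .
  obtain w where w: "w \<in> carrier R" "v = u \<otimes>\<^bsub>R\<^esub> w" using v(3) by blast
  show ?thesis
  proof (rule F.divides_power_imp_G_domain)
    show "v \<in> carrier (fixed_ring R G)" by (rule v(1))
    show "v \<noteq> \<zero>\<^bsub>fixed_ring R G\<^esub>" using v(2) by simp
    fix b assume b: "b \<in> carrier (fixed_ring R G)" "b \<noteq> \<zero>\<^bsub>fixed_ring R G\<^esub>"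
    then obtain n :: nat where n: "b divides\<^bsub>R\<^esub> u [^]\<^bsub>R\<^esub> n" using div[of b] by auto
    have "v [^]\<^bsub>R\<^esub> n = u [^]\<^bsub>R\<^esub> n \<otimes>\<^bsub>R\<^esub> w [^]\<^bsub>R\<^esub> n"
      using u w by (simp add: nat_pow_distrib)
    then have "b divides\<^bsub>R\<^esub> v [^]\<^bsub>R\<^esub> n"
      using n b u w by (auto intro: divides_prod_r)
    moreover have "v [^]\<^bsub>R\<^esub> n \<in> carrier (fixed_ring R G)"
      using F.nat_pow_closed[OF v(1), of n] by simp
    ultimately have "b divides\<^bsub>fixed_ring R G\<^esub> v [^]\<^bsub>R\<^esub> n"
      using b by (intro divides_fixed_ring[OF G]) auto
    then show "\<exists>n::nat. b divides\<^bsub>fixed_ring R G\<^esub> v [^]\<^bsub>fixed_ring R G\<^esub> n"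
      by auto
  qed
qed

end
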